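(* There is no $2$-connected nontrivial uniquely $C_9$-saturated graph whose longest even cycle of length at most $12$ is a chordless $8$-cycle. That is, there is no $2$-connected nontrivial uniquely $C_9$-saturated graph $G$ having a chordless $8$-cycle that is a longest cycle among all even cycles of $G$ of length at most $12$.
   Context: All graphs are finite and simple. A graph $G$ is uniquely $C_9$-saturated if it contains no cycle of length $9$ and, for every edge $e$ of the complement $\overline{G}$, $G+e$ contains exactly one cycle of length $9$; it is nontrivial if $|V(G)|\ge 9$. A cycle $C$ in $G$ is chordless if every edge of $G$ with both ends in $V(C)$ is an edge of $C$. *)

theory Defs
  imports "Graph_Theory.Graph_Theory"
begin

(* Finite simple graphs are the pair_graphs of the library: every edge {u, v} is
   represented by the two arcs (u, v) and (v, u). *)

(* |G| > 2, and deleting fewer than two vertices leaves a connected graph. *)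
definition two_connected :: "'a pair_pre_digraph \<Rightarrow> bool" where
  "two_connected G \<longleftrightarrow>
     card (pverts G) > 2 \<and> connected (with_proj G) \<and>
     (\<forall>v \<in> pverts G. connected (pre_digraph.del_vert (with_proj G) v))"

(* A cycle of an undirected graph is a subgraph. The library cycles are directed closed
   walks with a starting point; they are identified here up to rotation and reversal by
   passing to the undirected subgraph traversed. Back-and-forth walks along a single edge
   are library cycles of length 2 and have to be excluded. *)
definition walk_subgraph :: "('a \<times> 'a) awalk \<Rightarrow> 'a pair_pre_digraph" where
  "walk_subgraph p = \<lparr> pverts = fst ` set p \<union> snd ` set p, parcs = set p \<union> (set p)\<inverse> \<rparr>"

definition cycles :: "'a pair_pre_digraph \<Rightarrow> nat \<Rightarrow> 'a pair_pre_digraph set" where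
  "cycles G k =
     {walk_subgraph p | p. pre_digraph.cycle (with_proj G) p \<and> length p = k \<and> 3 \<le> k}"

definition add_edge :: "'a pair_pre_digraph \<Rightarrow> 'a \<Rightarrow> 'a \<Rightarrow> 'a pair_pre_digraph" where
  "add_edge G u v = G\<lparr> parcs := parcs G \<union> {(u, v), (v, u)} \<rparr>"

definition uniquely_cycle_saturated :: "nat \<Rightarrow> 'a pair_pre_digraph \<Rightarrow> bool" where
  "uniquely_cycle_saturated k G \<longleftrightarrow>
     cycles G k = {} \<and>
     (\<forall>u \<in> pverts G. \<forall>v \<in> pverts G. u \<noteq> v \<and> (u, v) \<notin> parcs G \<longrightarrow>
        (\<exists>!C. C \<in> cycles (add_edge G u v) k))"

definition nontrivial :: "nat \<Rightarrow> 'a pair_pre_digraph \<Rightarrow> bool" where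
  "nontrivial k G \<longleftrightarrow> card (pverts G) \<ge> k"

definition chordless :: "'a pair_pre_digraph \<Rightarrow> 'a pair_pre_digraph \<Rightarrow> bool" where
  "chordless G C \<longleftrightarrow>
     (\<forall>u v. (u, v) \<in> parcs G \<and> u \<in> pverts C \<and> v \<in> pverts C \<longrightarrow> (u, v) \<in> parcs C)"

definition longest_even_cycle_upto :: "nat \<Rightarrow> 'a pair_pre_digraph \<Rightarrow> 'a pair_pre_digraph \<Rightarrow> bool" where
  "longest_even_cycle_upto m G C \<longleftrightarrow>
     (\<exists>k. C \<in> cycles G k \<and> even k \<and> k \<le> m \<and>
        (\<forall>j D. D \<in> cycles G j \<and> even j \<and> j \<le> m \<longrightarrow> j \<le> k))"

end

theory Submission
  imports Defs
begin

text \<open>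
  Let \<open>C = c\<^sub>0 \<dots> c\<^sub>7\<close> be the chordless 8-cycle. Since 10 and 12 are even and at most 12, the graph
  has no cycle of length 9, 10 or 12. Two vertices are joined by at most one path of length 8: for
  non-adjacent vertices two such paths would become two 9-cycles after adding the edge, and for
  adjacent vertices one such path already closes to a 9-cycle. On the other hand \<open>c\<^sub>0\<close> and \<open>c\<^sub>2\<close> are
  not adjacent, so some path \<open>P\<close> of length 8 joins them. This path is what leads to the contradiction.

  Having only 9 vertices but one more than \<open>C\<close>, the path \<open>P\<close> leaves \<open>C\<close>, and each excursion is an
  \<^emph>\<open>ear\<close>: a path between two vertices of \<open>C\<close> with its interior off \<open>C\<close>. Write \<open>(l, d)\<close> for an ear
  of length \<open>l\<close> whose ends have distance \<open>d\<close> on \<open>C\<close>.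

  \<^item> No path hangs off \<open>C\<close> with four vertices outside: from the antipode of its foot, both ways
    round \<open>C\<close> would give a path of length 8 to its tip. So \<open>l \<le> 4\<close>, and the remaining pairs are
    eliminated by forbidden cycles and by pairs of paths with common ends, except for
    \<open>(2, 3)\<close>, \<open>(2, 4)\<close>, \<open>(3, 4)\<close> and \<open>(4, 1)\<close> (\<open>ear_span\<close>).
  \<^item> Two ears with disjoint interiors and different pairs of ends cannot coexist (\<open>no_two_ears\<close>).
    Up to the symmetries of \<open>C\<close> there are few relative positions, and each of them contains
    a forbidden cycle or two paths of length 8 with the same ends.
  \<^item> Hence \<open>P\<close> has exactly one ear. The steps of \<open>P\<close> along \<open>C\<close> change the parity of the index, so
    \<open>l\<close> and \<open>d\<close> have the same parity, which leaves only \<open>(2, 4)\<close>. Then \<open>P\<close> passes through all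
    of \<open>C\<close>, and a vertex of \<open>C\<close> that is neither an end of \<open>P\<close> nor of the ear must lie on \<open>P\<close>
    between its two neighbours on \<open>C\<close>. Applied to \<open>c\<^sub>1\<close>, or to \<open>c\<^sub>4\<close> and \<open>c\<^sub>6\<close> if the ear ends
    in \<open>c\<^sub>1\<close> and \<open>c\<^sub>5\<close>, this is absurd (\<open>no_path_via_one_ear\<close>).

  The combinatorial part is carried out with paths as vertex lists over an abstract adjacency
  relation; the last part translates the arc walks and subgraphs of the graph library to such lists.
\<close>

lemma first_excursion:
  assumes "xs \<noteq> []" "hd xs \<in> S" "last xs \<in> S" "\<not> set xs \<subseteq> S"
  obtains as a ws b bs where "xs = as @ a # ws @ b # bs" "set as \<subseteq> S" "a \<in> S" "b \<in> S"
    "ws \<noteq> []" "set ws \<inter> S = {}"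
proof -
  obtain pre w rest where out: "xs = pre @ w # rest" "w \<notin> S" "set pre \<subseteq> S"
    using split_list_first_prop[of xs "\<lambda>x. x \<notin> S"] assms(4) by blast
  then have "pre \<noteq> []"
    using assms(2) by auto
  then obtain as a where pre: "pre = as @ [a]"
    by (metis append_butlast_last_id)
  have "last (w # rest) \<in> S"
    using assms(3) out(1) by simp
  with out(2) have "\<exists>x\<in>set rest. x \<in> S"
    by (metis last_ConsL last_ConsR last_in_set)
  then obtain ws b bs where ret: "rest = ws @ b # bs" "b \<in> S" "\<forall>x\<in>set ws. x \<notin> S"
    using split_list_first_prop[of rest "\<lambda>x. x \<in> S"] by blast
  show ?thesis
    by (rule that[of as a "w # ws" b bs]) (use out pre ret in auto)
qed

section \<open>Ears of an octagon\<close>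

definition ear :: "('a \<Rightarrow> 'a \<Rightarrow> bool) \<Rightarrow> (int \<Rightarrow> 'a) \<Rightarrow> int \<Rightarrow> 'a list \<Rightarrow> int \<Rightarrow> bool" where
  "ear E c i xs j \<longleftrightarrow>
     xs \<noteq> [] \<and> distinct xs \<and> set xs \<inter> range c = {} \<and> successively E (c i # xs @ [c j])"

text \<open>
  The vertices of the octagon are indexed by all integers, with period 8, so that rotating the
  octagon is a shift of the index. The last two assumptions are what saturation and the choice of
  the octagon as a longest even cycle provide; a path of length 8 has 9 vertices.
\<close>

locale saturated_octagon =
  fixes E :: "'a \<Rightarrow> 'a \<Rightarrow> bool" and c :: "int \<Rightarrow> 'a"
  assumes E_sym: "E x y \<Longrightarrow> E y x"
    and c_eq: "c i = c j \<longleftrightarrow> i mod 8 = j mod 8"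
    and c_adj: "E (c i) (c j) \<longleftrightarrow> (i - j) mod 8 = 1 \<or> (i - j) mod 8 = 7"
    and no_cycle: "\<lbrakk>distinct xs; successively E xs; length xs \<in> {9, 10, 12}; E (last xs) (hd xs)\<rbrakk> \<Longrightarrow> False"
    and unique_path: "\<lbrakk>distinct xs; successively E xs; length xs = 9;
      distinct ys; successively E ys; length ys = 9; hd xs = hd ys; last xs = last ys\<rbrakk> \<Longrightarrow> xs = ys"
begin

text \<open>
  In the lists below, an ear that starts at a vertex \<open>c r\<close> with \<open>r \<le> 7\<close> ends at \<open>c (r + d)\<close> with
  \<open>d \<le> 4\<close>; these are the indices that need reducing.
\<close>

lemma c_wrap: "c 8 = c 0" "c 9 = c 1" "c 10 = c 2" "c 11 = c 3"
  by (simp_all add: c_eq)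

lemma ear_1: "ear E c i [w] j \<longleftrightarrow>
    E (c i) w \<and> E w (c i) \<and> E w (c j) \<and> E (c j) w \<and> (\<forall>k. w \<noteq> c k \<and> c k \<noteq> w)"
  by (auto simp: ear_def intro: E_sym)

lemma ear_2: "ear E c i [w, x] j \<longleftrightarrow>
    E (c i) w \<and> E w (c i) \<and> E w x \<and> E x w \<and> E x (c j) \<and> E (c j) x \<and> w \<noteq> x \<and> x \<noteq> w \<and>
    (\<forall>k. w \<noteq> c k \<and> c k \<noteq> w) \<and> (\<forall>k. x \<noteq> c k \<and> c k \<noteq> x)"
  by (auto simp: ear_def intro: E_sym)

lemma ear_3: "ear E c i [w, x, y] j \<longleftrightarrow>
    E (c i) w \<and> E w (c i) \<and> E w x \<and> E x w \<and> E x y \<and> E y x \<and> E y (c j) \<and> E (c j) y \<and>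
    w \<noteq> x \<and> x \<noteq> w \<and> w \<noteq> y \<and> y \<noteq> w \<and> x \<noteq> y \<and> y \<noteq> x \<and>
    (\<forall>k. w \<noteq> c k \<and> c k \<noteq> w) \<and> (\<forall>k. x \<noteq> c k \<and> c k \<noteq> x) \<and> (\<forall>k. y \<noteq> c k \<and> c k \<noteq> y)"
  by (auto simp: ear_def intro: E_sym)

lemmas edge_simps = ear_1 ear_2 ear_3 c_wrap c_eq c_adj

text \<open>Rotations allow every ear to be moved to start at \<open>c 0\<close>.\<close>

lemma rotate: "saturated_octagon E (\<lambda>k. c (i + k))"
proof
  show "c (i + k) = c (i + l) \<longleftrightarrow> k mod 8 = l mod 8" for k l
    by (simp add: c_eq mod_eq_dvd_iff)
  show "E (c (i + k)) (c (i + l)) \<longleftrightarrow> (k - l) mod 8 = 1 \<or> (k - l) mod 8 = 7" for k l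
    by (simp add: c_adj)
qed (fact E_sym no_cycle unique_path)+

lemma range_shift: "range (\<lambda>k. c (i + k)) = range c"
proof -
  have "range (\<lambda>k. c (i + k)) = c ` range ((+) i)"
    by (metis image_image)
  then show ?thesis
    by (metis surj_plus)
qed

lemma ear_rotate: "ear E (\<lambda>k. c (i + k)) k xs l \<longleftrightarrow> ear E c (i + k) xs (i + l)"
  by (simp add: ear_def range_shift)

lemma ear_cong: "c i = c k \<Longrightarrow> c j = c l \<Longrightarrow> ear E c i xs j \<longleftrightarrow> ear E c k xs l"
  by (simp add: ear_def)

lemma successively_rev_E: "successively E (rev xs) \<longleftrightarrow> successively E xs"
proof -
  have "E y x = E x y" for x y
    using E_sym by blast
  then have "(\<lambda>x y. E y x) = E"
    by (intro ext)
  then show ?thesis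
    by (metis successively_rev)
qed

lemma ear_rev: "ear E c i xs j \<Longrightarrow> ear E c j (rev xs) i"
  using successively_rev_E[of "c i # xs @ [c j]"] by (simp add: ear_def)

section \<open>The possible ears\<close>

text \<open>
  An ear with \<open>l\<close> edges and an arc of \<open>C\<close> between its ends with \<open>a\<close> edges form a cycle of length
  \<open>l + a\<close>, where \<open>a \<in> {d, 8 - d}\<close>; in the cases below this is 9 or 10 whenever a single list is given.
  If \<open>l = a\<close>, the ear can replace the arc and yields another 8-cycle sharing the other arc with
  \<open>C\<close>; then the neighbours of a common end on the ear and on the arc are joined by two
  paths of length 8, one around each of the two 8-cycles.
\<close>

lemma ear_span_1:
  assumes "ear E c 0 [w] d" "d \<in> {1..7}"
  shows "d = 3 \<or> d = 4 \<or> d = 5"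
proof -
  consider "d = 1" | "d = 2" | "d = 6" | "d = 7" | "d = 3 \<or> d = 4 \<or> d = 5"
    using assms(2) by fastforce
  then show ?thesis
  proof cases
    case 1
    show ?thesis using assms no_cycle[of "[c 0, w, c 1, c 2, c 3, c 4, c 5, c 6, c 7]"]
      by (simp add: 1 edge_simps)
  next
    case 2
    show ?thesis using assms unique_path[of "[c 1, c 0, c 7, c 6, c 5, c 4, c 3, c 2, w]"
      "[c 1, c 2, c 3, c 4, c 5, c 6, c 7, c 0, w]"]
      by (simp add: 2 edge_simps)
  next
    case 3
    show ?thesis using assms unique_path[of "[c 7, c 0, c 1, c 2, c 3, c 4, c 5, c 6, w]"
      "[c 7, c 6, c 5, c 4, c 3, c 2, c 1, c 0, w]"]
      by (simp add: 3 edge_simps)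
  next
    case 4
    show ?thesis using assms no_cycle[of "[c 0, w, c 7, c 6, c 5, c 4, c 3, c 2, c 1]"]
      by (simp add: 4 edge_simps)
  next
    case 5
    then show ?thesis .
  qed
qed

lemma ear_span_2:
  assumes "ear E c 0 [w, x] d" "d \<in> {1..7}"
  shows "d = 4"
proof -
  consider "d = 1" | "d = 2" | "d = 3" | "d = 5" | "d = 6" | "d = 7" | "d = 4"
    using assms(2) by fastforce
  then show ?thesis
  proof cases
    case 1
    show ?thesis using assms no_cycle[of "[c 0, w, x, c 1, c 2, c 3, c 4, c 5, c 6, c 7]"]
      by (simp add: 1 edge_simps)
  next
    case 2
    show ?thesis using assms no_cycle[of "[c 0, w, x, c 2, c 3, c 4, c 5, c 6, c 7]"]
      by (simp add: 2 edge_simps)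
  next
    case 3
    show ?thesis using assms unique_path[of "[c 1, c 0, c 7, c 6, c 5, c 4, c 3, x, w]"
      "[c 1, c 2, c 3, c 4, c 5, c 6, c 7, c 0, w]"]
      by (simp add: 3 edge_simps)
  next
    case 4
    show ?thesis using assms unique_path[of "[c 7, c 0, c 1, c 2, c 3, c 4, c 5, x, w]"
      "[c 7, c 6, c 5, c 4, c 3, c 2, c 1, c 0, w]"]
      by (simp add: 4 edge_simps)
  next
    case 5
    show ?thesis using assms no_cycle[of "[c 0, w, x, c 6, c 5, c 4, c 3, c 2, c 1]"]
      by (simp add: 5 edge_simps)
  next
    case 6
    show ?thesis using assms no_cycle[of "[c 0, w, x, c 7, c 6, c 5, c 4, c 3, c 2, c 1]"]
      by (simp add: 6 edge_simps)
  next
    case 7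
    then show ?thesis .
  qed
qed

lemma ear_span_3:
  assumes "ear E c 0 [w, x, y] d" "d \<in> {1..7}"
  shows "d = 1 \<or> d = 7"
proof -
  consider "d = 2" | "d = 3" | "d = 4" | "d = 5" | "d = 6" | "d = 1 \<or> d = 7"
    using assms(2) by fastforce
  then show ?thesis
  proof cases
    case 1
    show ?thesis using assms no_cycle[of "[c 0, w, x, y, c 2, c 3, c 4, c 5, c 6, c 7]"]
      by (simp add: 1 edge_simps)
  next
    case 2
    show ?thesis using assms no_cycle[of "[c 0, w, x, y, c 3, c 4, c 5, c 6, c 7]"]
      by (simp add: 2 edge_simps)
  next
    case 3
    show ?thesis using assms unique_path[of "[c 1, c 0, c 7, c 6, c 5, c 4, y, x, w]"
      "[c 1, c 2, c 3, c 4, c 5, c 6, c 7, c 0, w]"]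
      by (simp add: 3 edge_simps)
  next
    case 4
    show ?thesis using assms no_cycle[of "[c 0, w, x, y, c 5, c 4, c 3, c 2, c 1]"]
      by (simp add: 4 edge_simps)
  next
    case 5
    show ?thesis using assms no_cycle[of "[c 0, w, x, y, c 6, c 5, c 4, c 3, c 2, c 1]"]
      by (simp add: 5 edge_simps)
  next
    case 6
    then show ?thesis .
  qed
qed

text \<open>The first four interior vertices \<open>w, x, y, z\<close> of a longer ear can be reached from the antipode
  \<open>c 4\<close> of \<open>c 0\<close> along either half of the octagon, each time in 8 steps.\<close>

lemma ear_length_at_0:
  assumes "ear E c 0 xs j"
  shows "length xs \<le> 3"
proof (rule ccontr)
  assume "\<not> length xs \<le> 3"
  then have "length xs = Suc (Suc (Suc (Suc (length xs - 4))))"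
    by simp
  then obtain w x y z zs where xs: "xs = w # x # y # z # zs"
    by (metis length_Suc_conv)
  with assms have "\<forall>v\<in>{w, x, y, z}. \<forall>k. v \<noteq> c k \<and> c k \<noteq> v"
    by (auto simp: ear_def)
  with assms xs show False
    using unique_path[of "[c 4, c 3, c 2, c 1, c 0, w, x, y, z]"
      "[c 4, c 5, c 6, c 7, c 0, w, x, y, z]"]
    by (auto simp: ear_def c_eq c_adj)
qed

lemma length_1_2_3:
  "length xs = Suc 0 \<longleftrightarrow> (\<exists>w. xs = [w])"
  "length xs = 2 \<longleftrightarrow> (\<exists>w x. xs = [w, x])"
  "length xs = 3 \<longleftrightarrow> (\<exists>w x y. xs = [w, x, y])"
  by (auto simp: length_Suc_conv numeral_eq_Suc)

lemma ear_span_at_0: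
  assumes "ear E c 0 xs d" "d \<in> {1..7}"
  shows "(length xs, d) \<in> {(1, 3), (1, 4), (1, 5), (2, 4), (3, 1), (3, 7)}"
proof -
  have "xs \<noteq> []"
    using assms(1) by (simp add: ear_def)
  with ear_length_at_0[OF assms(1)] consider "length xs = Suc 0" | "length xs = 2" | "length xs = 3"
    by (cases "length xs") force+
  then show ?thesis
  proof cases
    case 1
    then obtain w where "xs = [w]" by (auto simp: length_1_2_3)
    then show ?thesis using assms ear_span_1[of w d] by auto
  next
    case 2
    then obtain w x where "xs = [w, x]" by (auto simp: length_1_2_3)
    then show ?thesis using assms ear_span_2[of w x d] by auto
  next
    case 3
    then obtain w x y where "xs = [w, x, y]" by (auto simp: length_1_2_3)
    then show ?thesis using assms ear_span_3[of w x y d] by auto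
  qed
qed

lemma ear_span:
  assumes "ear E c i xs j" "c i \<noteq> c j"
  shows "(length xs, (j - i) mod 8) \<in> {(1, 3), (1, 4), (1, 5), (2, 4), (3, 1), (3, 7)}"
proof -
  have "c (i + (j - i) mod 8) = c j"
    by (simp add: c_eq mod_simps)
  then have "ear E (\<lambda>k. c (i + k)) 0 xs ((j - i) mod 8)"
    using assms(1) by (simp add: ear_rotate ear_def range_shift)
  moreover have "(j - i) mod 8 \<in> {1..7}"
  proof -
    have "(j - i) mod 8 \<noteq> 0"
      using assms(2) c_eq[of j i] by (simp add: mod_eq_dvd_iff dvd_eq_mod_eq_0)
    then show ?thesis
      using pos_mod_bound[of 8 "j - i"] pos_mod_sign[of 8 "j - i"] by auto
  qed
  ultimately show ?thesis
    by (rule saturated_octagon.ear_span_at_0[OF rotate])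
qed

text \<open>Reading the ears that span 5 or 7 steps backwards makes them span 3 or 1, so that one orientation
  of each of the four kinds is enough in the comparison of two ears.\<close>

lemma ear_standard:
  assumes "ear E c i xs j" "c i \<noteq> c j"
  obtains p ys e where "ear E c p ys (p + e)" "set ys = set xs" "{c p, c (p + e)} = {c i, c j}"
    "(length ys, e) \<in> {(1, 3), (1, 4), (2, 4), (3, 1)}"
proof -
  define d where "d = (j - i) mod 8"
  have "8 dvd j - i - d"
    by (simp add: d_def)
  then have j: "c (i + d) = c j" and i: "c (j + (8 - d)) = c i"
    by (simp_all add: c_eq mod_eq_dvd_iff) presburger+
  from ear_span[OF assms] consider "(length xs, d) \<in> {(1, 3), (1, 4), (2, 4), (3, 1)}"
    | "(length xs, d) \<in> {(1, 5), (3, 7)}"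
    unfolding d_def by auto
  then show ?thesis
  proof cases
    case 1
    then show ?thesis
      using that[of i xs d] assms(1) j by (simp add: ear_def)
  next
    case 2
    then show ?thesis
      using that[of j "rev xs" "8 - d"] ear_rev[OF assms(1)] i by (auto simp: ear_def)
  qed
qed

section \<open>Conflicting pairs of ears\<close>

text \<open>
  In the name of each of the next lemmas, the first number stands for an ear at \<open>c 0\<close> and the second
  for an ear at \<open>c r\<close>; \<open>41\<close> denotes an ear of length 4 that spans 1 step of the octagon, and
  similarly \<open>23\<close>, \<open>24\<close>, \<open>34\<close>. Each position of the second ear is refuted by a single list, which is
  the vertex sequence of a cycle of length 9, 10 or 12, or by two lists, which are different
  paths of length 8 with the same ends. They come from three sources.

  \<^item> Replacing an edge by a 41-ear makes a cycle longer by 3. A 24-ear and half of the octagon form a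
    6-cycle and a 34-ear and half of the octagon a 7-cycle; choosing the half that contains the
    replaced edge gives lengths 9 and 10. Two 41-ears whose edges lie on a common arc of length 5
    can each be inserted into that arc, which gives two paths of length 8.
  \<^item> Two ears whose ends interlace on the octagon form a cycle together with two opposite arcs
    between their ends, and there are two choices for these arcs.
  \<^item> In most of the other cases, two routes of equal length between the same two vertices, each
    consisting of ears and arcs, are exchanged for each other within a path of length 8. The few
    remaining pairs of paths run through the ears and arcs in different orders.
\<close>

lemma conflict_41_41:
  assumes "ear E c 0 [w1, w2, w3] 1" "ear E c r [x1, x2, x3] (r + 1)"
    and "set [w1, w2, w3] \<inter> set [x1, x2, x3] = {}" "r \<in> {0..7}"
  shows False
proof -
  consider "r = 0" | "r = 1" | "r = 2" | "r = 3" | "r = 4" | "r = 5" | "r = 6" | "r = 7"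
    using assms(4) by fastforce
  then show False
  proof cases
    case 1
    show False using assms unique_path[of "[c 0, w1, w2, w3, c 1, c 2, c 3, c 4, c 5]"
      "[c 0, x1, x2, x3, c 1, c 2, c 3, c 4, c 5]"]
      by (auto simp: 1 edge_simps)
  next
    case 2
    show False using assms unique_path[of "[c 0, c 1, x1, x2, x3, c 2, c 3, c 4, c 5]"
      "[c 0, w1, w2, w3, c 1, c 2, c 3, c 4, c 5]"]
      by (auto simp: 2 edge_simps)
  next
    case 3
    show False using assms unique_path[of "[c 0, c 1, c 2, x1, x2, x3, c 3, c 4, c 5]"
      "[c 0, w1, w2, w3, c 1, c 2, c 3, c 4, c 5]"]
      by (auto simp: 3 edge_simps)
  next
    case 4
    show False using assms unique_path[of "[w1, c 0, c 1, c 2, c 3, c 4, x3, x2, x1]"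
      "[w1, c 0, c 7, c 6, c 5, c 4, x3, x2, x1]"]
      by (auto simp: 4 edge_simps)
  next
    case 5
    show False using assms unique_path[of "[w1, c 0, c 1, c 2, c 3, c 4, x1, x2, x3]"
      "[w1, c 0, c 7, c 6, c 5, c 4, x1, x2, x3]"]
      by (auto simp: 5 edge_simps)
  next
    case 6
    show False using assms unique_path[of "[w1, w2, w3, c 1, c 0, c 7, c 6, c 5, x1]"
      "[w1, w2, w3, c 1, c 2, c 3, c 4, c 5, x1]"]
      by (auto simp: 6 edge_simps)
  next
    case 7
    show False using assms unique_path[of "[c 1, c 0, c 7, x3, x2, x1, c 6, c 5, c 4]"
      "[c 1, w3, w2, w1, c 0, c 7, c 6, c 5, c 4]"]
      by (auto simp: 7 edge_simps)
  next
    case 8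
    show False using assms unique_path[of "[c 1, c 0, x3, x2, x1, c 7, c 6, c 5, c 4]"
      "[c 1, w3, w2, w1, c 0, c 7, c 6, c 5, c 4]"]
      by (auto simp: 8 edge_simps)
  qed
qed

lemma conflict_41_23:
  assumes "ear E c 0 [w1, w2, w3] 1" "ear E c r [x1] (r + 3)"
    and "set [w1, w2, w3] \<inter> set [x1] = {}" "r \<in> {0..7}"
  shows False
proof -
  consider "r = 0" | "r = 1" | "r = 2" | "r = 3" | "r = 4" | "r = 5" | "r = 6" | "r = 7"
    using assms(4) by fastforce
  then show False
  proof cases
    case 1
    show False using assms unique_path[of "[c 1, c 2, c 3, x1, c 0, c 7, c 6, c 5, c 4]"
      "[c 1, w3, w2, w1, c 0, c 7, c 6, c 5, c 4]"]
      by (auto simp: 1 edge_simps)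
  next
    case 2
    show False using assms no_cycle[of "[c 0, c 7, c 6, c 5, c 4, x1, c 1, w3, w2, w1]"]
      by (auto simp: 2 edge_simps)
  next
    case 3
    show False using assms no_cycle[of "[c 0, c 7, c 6, c 5, x1, c 2, c 1, w3, w2, w1]"]
      by (auto simp: 3 edge_simps)
  next
    case 4
    show False using assms no_cycle[of "[c 0, c 7, c 6, x1, c 3, c 2, c 1, w3, w2, w1]"]
      by (auto simp: 4 edge_simps)
  next
    case 5
    show False using assms no_cycle[of "[c 0, c 7, x1, c 4, c 3, c 2, c 1, w3, w2, w1]"]
      by (auto simp: 5 edge_simps)
  next
    case 6
    show False using assms no_cycle[of "[c 0, w1, w2, w3, c 1, c 2, c 3, c 4, c 5, x1]"]
      by (auto simp: 6 edge_simps)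
  next
    case 7
    show False using assms unique_path[of "[c 0, c 7, c 6, x1, c 1, c 2, c 3, c 4, c 5]"
      "[c 0, w1, w2, w3, c 1, c 2, c 3, c 4, c 5]"]
      by (auto simp: 7 edge_simps)
  next
    case 8
    show False using assms unique_path[of "[c 3, c 4, c 5, c 6, c 7, c 0, w1, w2, w3]"
      "[c 3, c 4, c 5, c 6, c 7, x1, c 2, c 1, w3]"]
      by (auto simp: 8 edge_simps)
  qed
qed

lemma conflict_41_24:
  assumes "ear E c 0 [w1, w2, w3] 1" "ear E c r [x1] (r + 4)"
    and "set [w1, w2, w3] \<inter> set [x1] = {}" "r \<in> {0..3}"
  shows False
proof -
  consider "r = 0" | "r = 1" | "r = 2" | "r = 3"
    using assms(4) by fastforce
  then show False
  proof cases
    case 1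
    show False using assms no_cycle[of "[c 0, w1, w2, w3, c 1, c 2, c 3, c 4, x1]"]
      by (auto simp: 1 edge_simps)
  next
    case 2
    show False using assms no_cycle[of "[c 0, c 7, c 6, c 5, x1, c 1, w3, w2, w1]"]
      by (auto simp: 2 edge_simps)
  next
    case 3
    show False using assms no_cycle[of "[c 0, c 7, c 6, x1, c 2, c 1, w3, w2, w1]"]
      by (auto simp: 3 edge_simps)
  next
    case 4
    show False using assms no_cycle[of "[c 0, c 7, x1, c 3, c 2, c 1, w3, w2, w1]"]
      by (auto simp: 4 edge_simps)
  qed
qed

lemma conflict_41_34:
  assumes "ear E c 0 [w1, w2, w3] 1" "ear E c r [x1, x2] (r + 4)"
    and "set [w1, w2, w3] \<inter> set [x1, x2] = {}" "r \<in> {0..3}"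
  shows False
proof -
  consider "r = 0" | "r = 1" | "r = 2" | "r = 3"
    using assms(4) by fastforce
  then show False
  proof cases
    case 1
    show False using assms no_cycle[of "[c 0, w1, w2, w3, c 1, c 2, c 3, c 4, x2, x1]"]
      by (auto simp: 1 edge_simps)
  next
    case 2
    show False using assms no_cycle[of "[c 0, c 7, c 6, c 5, x2, x1, c 1, w3, w2, w1]"]
      by (auto simp: 2 edge_simps)
  next
    case 3
    show False using assms no_cycle[of "[c 0, c 7, c 6, x2, x1, c 2, c 1, w3, w2, w1]"]
      by (auto simp: 3 edge_simps)
  next
    case 4
    show False using assms no_cycle[of "[c 0, c 7, x2, x1, c 3, c 2, c 1, w3, w2, w1]"]
      by (auto simp: 4 edge_simps)
  qed
qed

lemma conflict_23_23:
  assumes "ear E c 0 [w1] 3" "ear E c r [x1] (r + 3)"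
    and "set [w1] \<inter> set [x1] = {}" "r \<in> {0..7}"
  shows False
proof -
  consider "r = 0" | "r = 1" | "r = 2" | "r = 3" | "r = 4" | "r = 5" | "r = 6" | "r = 7"
    using assms(4) by fastforce
  then show False
  proof cases
    case 1
    show False using assms unique_path[of "[c 1, c 2, c 3, w1, c 0, c 7, c 6, c 5, c 4]"
      "[c 1, c 2, c 3, x1, c 0, c 7, c 6, c 5, c 4]"]
      by (auto simp: 1 edge_simps)
  next
    case 2
    show False using assms no_cycle[of "[c 0, c 7, c 6, c 5, c 4, x1, c 1, c 2, c 3, w1]"]
      by (auto simp: 2 edge_simps)
  next
    case 3
    show False using assms unique_path[of "[c 1, c 0, c 7, c 6, c 5, c 4, c 3, c 2, x1]"
      "[c 1, c 2, c 3, w1, c 0, c 7, c 6, c 5, x1]"]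
      by (auto simp: 3 edge_simps)
  next
    case 4
    show False using assms unique_path[of "[c 2, c 1, c 0, c 7, c 6, c 5, c 4, c 3, x1]"
      "[c 2, c 1, c 0, w1, c 3, c 4, c 5, c 6, x1]"]
      by (auto simp: 4 edge_simps)
  next
    case 5
    show False using assms unique_path[of "[c 1, c 0, w1, c 3, c 4, x1, c 7, c 6, c 5]"
      "[c 1, c 2, c 3, w1, c 0, c 7, x1, c 4, c 5]"]
      by (auto simp: 5 edge_simps)
  next
    case 6
    show False using assms unique_path[of "[c 1, c 2, c 3, c 4, c 5, c 6, c 7, c 0, x1]"
      "[c 1, c 2, c 3, w1, c 0, c 7, c 6, c 5, x1]"]
      by (auto simp: 6 edge_simps)
  next
    case 7
    show False using assms unique_path[of "[c 2, c 1, c 0, c 7, c 6, c 5, c 4, c 3, w1]"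
      "[c 2, c 3, c 4, c 5, c 6, x1, c 1, c 0, w1]"]
      by (auto simp: 7 edge_simps)
  next
    case 8
    show False using assms no_cycle[of "[c 0, c 1, c 2, x1, c 7, c 6, c 5, c 4, c 3, w1]"]
      by (auto simp: 8 edge_simps)
  qed
qed

lemma conflict_23_24:
  assumes "ear E c 0 [w1] 3" "ear E c r [x1] (r + 4)"
    and "set [w1] \<inter> set [x1] = {}" "r \<in> {0..3}"
  shows False
proof -
  consider "r = 0" | "r = 1" | "r = 2" | "r = 3"
    using assms(4) by fastforce
  then show False
  proof cases
    case 1
    show False using assms unique_path[of "[c 2, c 1, c 0, w1, c 3, c 4, c 5, c 6, c 7]"
      "[c 2, c 3, w1, c 0, x1, c 4, c 5, c 6, c 7]"]
      by (auto simp: 1 edge_simps)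
  next
    case 2
    show False using assms no_cycle[of "[c 0, c 7, c 6, c 5, x1, c 1, c 2, c 3, w1]"]
      by (auto simp: 2 edge_simps)
  next
    case 3
    show False using assms no_cycle[of "[c 0, c 1, c 2, x1, c 6, c 5, c 4, c 3, w1]"]
      by (auto simp: 3 edge_simps)
  next
    case 4
    show False using assms unique_path[of "[c 1, c 0, w1, c 3, x1, c 7, c 6, c 5, c 4]"
      "[c 1, c 2, c 3, w1, c 0, c 7, c 6, c 5, c 4]"]
      by (auto simp: 4 edge_simps)
  qed
qed

lemma conflict_23_34:
  assumes "ear E c 0 [w1] 3" "ear E c r [x1, x2] (r + 4)"
    and "set [w1] \<inter> set [x1, x2] = {}" "r \<in> {0..3}"
  shows False
proof -
  consider "r = 0" | "r = 1" | "r = 2" | "r = 3"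
    using assms(4) by fastforce
  then show False
  proof cases
    case 1
    show False using assms unique_path[of "[c 2, c 1, c 0, w1, c 3, c 4, c 5, c 6, c 7]"
      "[c 2, c 1, c 0, x1, x2, c 4, c 5, c 6, c 7]"]
      by (auto simp: 1 edge_simps)
  next
    case 2
    show False using assms no_cycle[of "[c 0, c 7, c 6, c 5, x2, x1, c 1, c 2, c 3, w1]"]
      by (auto simp: 2 edge_simps)
  next
    case 3
    show False using assms no_cycle[of "[c 0, c 1, c 2, x1, x2, c 6, c 5, c 4, c 3, w1]"]
      by (auto simp: 3 edge_simps)
  next
    case 4
    show False using assms unique_path[of "[c 1, c 2, c 3, w1, c 0, c 7, c 6, c 5, c 4]"
      "[c 1, c 2, c 3, x1, x2, c 7, c 6, c 5, c 4]"]
      by (auto simp: 4 edge_simps)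
  qed
qed

lemma conflict_24_24:
  assumes "ear E c 0 [w1] 4" "ear E c r [x1] (r + 4)"
    and "set [w1] \<inter> set [x1] = {}" "r \<in> {1..3}"
  shows False
proof -
  consider "r = 1" | "r = 2" | "r = 3"
    using assms(4) by fastforce
  then show False
  proof cases
    case 1
    show False using assms no_cycle[of "[c 0, c 7, c 6, c 5, x1, c 1, c 2, c 3, c 4, w1]"]
      by (auto simp: 1 edge_simps)
  next
    case 2
    show False using assms unique_path[of "[c 1, c 0, c 7, c 6, x1, c 2, c 3, c 4, c 5]"
      "[c 1, c 0, w1, c 4, c 3, c 2, x1, c 6, c 5]"]
      by (auto simp: 2 edge_simps)
  next
    case 3
    show False using assms no_cycle[of "[c 0, c 1, c 2, c 3, x1, c 7, c 6, c 5, c 4, w1]"]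
      by (auto simp: 3 edge_simps)
  qed
qed

lemma conflict_24_34:
  assumes "ear E c 0 [w1] 4" "ear E c r [x1, x2] (r + 4)"
    and "set [w1] \<inter> set [x1, x2] = {}" "r \<in> {1..3}"
  shows False
proof -
  consider "r = 1" | "r = 2" | "r = 3"
    using assms(4) by fastforce
  then show False
  proof cases
    case 1
    show False using assms unique_path[of "[c 0, c 7, c 6, c 5, x2, x1, c 1, c 2, c 3]"
      "[c 0, w1, c 4, c 5, x2, x1, c 1, c 2, c 3]"]
      by (auto simp: 1 edge_simps)
  next
    case 2
    show False using assms no_cycle[of "[c 0, c 1, c 2, x1, x2, c 6, c 5, c 4, w1]"]
      by (auto simp: 2 edge_simps)
  next
    case 3
    show False using assms unique_path[of "[c 0, c 1, c 2, c 3, x1, x2, c 7, c 6, c 5]"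
      "[c 0, w1, c 4, c 3, x1, x2, c 7, c 6, c 5]"]
      by (auto simp: 3 edge_simps)
  qed
qed

lemma conflict_34_34:
  assumes "ear E c 0 [w1, w2] 4" "ear E c r [x1, x2] (r + 4)"
    and "set [w1, w2] \<inter> set [x1, x2] = {}" "r \<in> {1..3}"
  shows False
proof -
  consider "r = 1" | "r = 2" | "r = 3"
    using assms(4) by fastforce
  then show False
  proof cases
    case 1
    show False using assms no_cycle[of "[c 0, c 7, c 6, c 5, x2, x1, c 1, c 2, c 3, c 4, w2, w1]"]
      by (auto simp: 1 edge_simps)
  next
    case 2
    show False using assms no_cycle[of "[c 0, c 1, c 2, x1, x2, c 6, c 5, c 4, w2, w1]"]
      by (auto simp: 2 edge_simps)
  next
    case 3
    show False using assms no_cycle[of "[c 0, c 1, c 2, c 3, x1, x2, c 7, c 6, c 5, c 4, w2, w1]"]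
      by (auto simp: 3 edge_simps)
  qed
qed

text \<open>An ear that spans 4 steps can be read from either end, so \<open>r \<le> 3\<close> covers all its positions.
  If both ears span 4 steps, \<open>r = 0\<close> means that they have the same two ends. This is excluded
  because a 24-ear and a 34-ear with common ends satisfy all the constraints.\<close>

lemma no_two_ears_at_0:
  assumes ears: "ear E c 0 xs d" "ear E c r ys (r + e)" "set xs \<inter> set ys = {}"
    and r: "r \<in> {0..7}" "e = 4 \<Longrightarrow> r \<in> {0..3}" "d = 4 \<Longrightarrow> e = 4 \<Longrightarrow> r \<in> {1..3}"
    and types: "((length xs, d), (length ys, e)) \<in>
      {((3, 1), (3, 1)), ((3, 1), (1, 3)), ((3, 1), (1, 4)), ((3, 1), (2, 4)), ((1, 3), (1, 3)),
       ((1, 3), (1, 4)), ((1, 3), (2, 4)), ((1, 4), (1, 4)), ((1, 4), (2, 4)), ((2, 4), (2, 4))}"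
  shows False
proof -
  consider (types_41_41) w1 w2 w3 x1 x2 x3 where "xs = [w1, w2, w3]" "d = 1" "ys = [x1, x2, x3]" "e = 1"
    | (types_41_23) w1 w2 w3 x1 where "xs = [w1, w2, w3]" "d = 1" "ys = [x1]" "e = 3"
    | (types_41_24) w1 w2 w3 x1 where "xs = [w1, w2, w3]" "d = 1" "ys = [x1]" "e = 4"
    | (types_41_34) w1 w2 w3 x1 x2 where "xs = [w1, w2, w3]" "d = 1" "ys = [x1, x2]" "e = 4"
    | (types_23_23) w1 x1 where "xs = [w1]" "d = 3" "ys = [x1]" "e = 3"
    | (types_23_24) w1 x1 where "xs = [w1]" "d = 3" "ys = [x1]" "e = 4"
    | (types_23_34) w1 x1 x2 where "xs = [w1]" "d = 3" "ys = [x1, x2]" "e = 4"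
    | (types_24_24) w1 x1 where "xs = [w1]" "d = 4" "ys = [x1]" "e = 4"
    | (types_24_34) w1 x1 x2 where "xs = [w1]" "d = 4" "ys = [x1, x2]" "e = 4"
    | (types_34_34) w1 w2 x1 x2 where "xs = [w1, w2]" "d = 4" "ys = [x1, x2]" "e = 4"
    using types by (elim insertE emptyE) (auto simp: length_1_2_3)
  then show False
  proof cases
    case types_41_41
    then show ?thesis using conflict_41_41 ears r by blast
  next
    case types_41_23
    then show ?thesis using conflict_41_23 ears r by blast
  next
    case types_41_24
    then show ?thesis using conflict_41_24 ears r by blast
  next
    case types_41_34
    then show ?thesis using conflict_41_34 ears r by blast
  next
    case types_23_23
    then show ?thesis using conflict_23_23 ears r by blast
  next
    case types_23_24
    then show ?thesis using conflict_23_24 ears r by blast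
  next
    case types_23_34
    then show ?thesis using conflict_23_34 ears r by blast
  next
    case types_24_24
    then show ?thesis using conflict_24_24 ears r by blast
  next
    case types_24_34
    then show ?thesis using conflict_24_34 ears r by blast
  next
    case types_34_34
    then show ?thesis using conflict_34_34 ears r by blast
  qed
qed

text \<open>The first ear is rotated to \<open>c 0\<close>. If the second one spans 4 steps and then starts beyond \<open>c 3\<close>,
  it is read backwards.\<close>

lemma no_two_ears_ordered:
  assumes ears: "ear E c p xs (p + d)" "ear E c q ys (q + e)" "set xs \<inter> set ys = {}"
    and ends: "{c p, c (p + d)} \<noteq> {c q, c (q + e)}"
    and types: "((length xs, d), (length ys, e)) \<in>
      {((3, 1), (3, 1)), ((3, 1), (1, 3)), ((3, 1), (1, 4)), ((3, 1), (2, 4)), ((1, 3), (1, 3)),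
       ((1, 3), (1, 4)), ((1, 3), (2, 4)), ((1, 4), (1, 4)), ((1, 4), (2, 4)), ((2, 4), (2, 4))}"
  shows False
proof -
  interpret rotated: saturated_octagon E "\<lambda>k. c (p + k)"
    by (rule rotate)
  define r where "r = (q - p) mod 8"
  have r: "r \<in> {0..7}"
    using pos_mod_bound[of 8 "q - p"] by (simp add: r_def)
  have "8 dvd q - p - r"
    by (simp add: r_def)
  then have shift: "c (p + (r + k)) = c (q + k)" for k
    by (simp add: c_eq mod_eq_dvd_iff) presburger
  have first: "ear E (\<lambda>k. c (p + k)) 0 xs d"
    using ears(1) by (simp add: ear_rotate)
  have second: "ear E (\<lambda>k. c (p + k)) r ys (r + e)"
    using ears(2) shift[of 0] shift[of e] by (simp add: ear_def range_shift)
  show False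
  proof (cases "e = 4 \<and> 4 \<le> r")
    case False
    have "r \<noteq> 0" if "d = 4" "e = 4"
      using ends shift[of 0] shift[of 4] that by auto
    then show False
      using False r rotated.no_two_ears_at_0[OF first second ears(3) r _ _ types] by force
  next
    case True
    then have "ear E (\<lambda>k. c (p + k)) (r - 4) (rev ys) (r - 4 + e)"
      using rotated.ear_rev[OF second] rotated.ear_cong[of "r + e" "r - 4" r "r - 4 + e"]
        rotated.c_eq[of "r + e" "r - 4"]
      by (simp add: mod_eq_dvd_iff)
    moreover have "r \<noteq> 4" if "d = 4" "e = 4"
    proof
      assume "r = 4"
      then have "c q = c (p + d)" "c (q + e) = c p"
        using that shift[of 0] shift[of 4] c_eq[of "p + 8" p] by simp_all
      with ends show False by auto
    qed
    ultimately show False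
      using True r ears(3) types rotated.no_two_ears_at_0[OF first, of "r - 4" "rev ys" e] by force
  qed
qed

lemma no_two_ears:
  assumes "ear E c i xs j" "c i \<noteq> c j" "ear E c k ys l" "c k \<noteq> c l"
    and "set xs \<inter> set ys = {}" "{c i, c j} \<noteq> {c k, c l}"
  shows False
proof -
  obtain p xs' d where first: "ear E c p xs' (p + d)" "set xs' = set xs" "{c p, c (p + d)} = {c i, c j}"
    "(length xs', d) \<in> {(1, 3), (1, 4), (2, 4), (3, 1)}"
    using ear_standard assms(1,2) by blast
  obtain q ys' e where second: "ear E c q ys' (q + e)" "set ys' = set ys" "{c q, c (q + e)} = {c k, c l}"
    "(length ys', e) \<in> {(1, 3), (1, 4), (2, 4), (3, 1)}"
    using ear_standard assms(3,4) by blast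
  have disj: "set xs' \<inter> set ys' = {}" "set ys' \<inter> set xs' = {}"
    and ends: "{c p, c (p + d)} \<noteq> {c q, c (q + e)}" "{c q, c (q + e)} \<noteq> {c p, c (p + d)}"
    using first second assms(5,6) by auto
  show False
    using no_two_ears_ordered[OF first(1) second(1) disj(1) ends(1)]
      no_two_ears_ordered[OF second(1) first(1) disj(2) ends(2)] first(4) second(4)
    by (elim insertE emptyE) simp_all
qed

section \<open>The path of length 8 between vertices at distance 2\<close>

text \<open>The octagon is bipartite, with the parity of the index as colour. The parity is well defined
  although the indices are only determined modulo 8.\<close>

lemma octagon_walk_parity:
  assumes "successively E xs" "set xs \<subseteq> range c" "xs \<noteq> []" "hd xs = c i" "last xs = c j"
  shows "odd (j - i + int (length xs))"
  using assms
proof (induction xs arbitrary: i)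
  case (Cons x xs)
  show ?case
  proof (cases "xs = []")
    case True
    with Cons.prems have "8 dvd j - i"
      by (simp add: c_eq flip: mod_eq_dvd_iff)
    then have "even (j - i)"
      by (rule dvd_trans[rotated]) simp
    with True show ?thesis by simp
  next
    case False
    with Cons.prems obtain k where k: "hd xs = c k"
      by (metis hd_in_set imageE insert_subset list.simps(15) subsetD)
    with False Cons.prems have "(i - k) mod 8 = 1 \<or> (i - k) mod 8 = 7"
      by (auto simp: successively_Cons c_adj)
    moreover have "odd x" if "x mod 8 = 1 \<or> x mod 8 = 7" for x :: int
      using that by presburger
    ultimately have "odd (i - k)"
      by blast
    moreover have "odd (j - k + int (length xs))"
      using Cons.IH[of k] Cons.prems False k by (simp add: successively_Cons)
    ultimately show ?thesis
      by auto
  qed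
qed simp

lemma range_octagon: "range c = c ` {0..7}"
proof -
  have "c k \<in> c ` {0..7}" for k
    by (rule image_eqI[of _ _ "k mod 8"]) (simp_all add: c_eq)
  then show ?thesis by auto
qed

lemma card_octagon: "card (range c) = 8"
proof -
  have "inj_on c {0..7}"
    by (auto simp: inj_on_def c_eq)
  then show ?thesis
    by (simp add: range_octagon card_image)
qed

lemma octagon_neighbour: "E (c m) (c a) \<Longrightarrow> c a = c (m + 1) \<or> c a = c (m - 1)"
proof -
  assume "E (c m) (c a)"
  moreover have "x mod 8 = 1 \<Longrightarrow> 8 dvd 1 - x" "x mod 8 = 7 \<Longrightarrow> 8 dvd - 1 - x" for x :: int
    by presburger+
  ultimately have "8 dvd 1 - (m - a) \<or> 8 dvd - 1 - (m - a)"
    unfolding c_adj by blast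
  then show "c a = c (m + 1) \<or> c a = c (m - 1)"
    unfolding c_eq mod_eq_dvd_iff by (auto simp: algebra_simps)
qed

text \<open>Parity forces the ear to have a single vertex \<open>w\<close> and antipodal ends. The path then has 8 vertices
  left for the octagon, so it visits all of it; vertices that are not ends of the ear have only their
  two octagon neighbours available. If \<open>c 1\<close> is such a vertex, the path is just \<open>c 0, c 1, c 2\<close>.
  Otherwise \<open>c 5\<close> is the other end of the ear and would be next to \<open>c 4\<close>, to \<open>c 6\<close> and to \<open>w\<close>.\<close>

lemma no_path_via_one_ear:
  assumes P: "distinct P" "successively E P" "length P = 9" "hd P = c 0" "last P = c 2"
    and dec: "P = as @ c i # ws @ c j # bs" "set as \<subseteq> range c" "set bs \<subseteq> range c"
    and ear: "ear E c i ws j"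
  shows False
proof -
  have dist: "c i \<noteq> c j" and lens: "length as + length ws + length bs = 7"
    using P(1,3) dec(1) by auto
  then have odd_lens: "odd (length as + length ws + length bs)"
    by simp
  have "odd (i - 0 + int (length (as @ [c i])))"
  proof (rule octagon_walk_parity)
    show "hd (as @ [c i]) = c 0"
      using P(4) dec(1) by (cases as) auto
  qed (use P dec in \<open>auto simp: successively_append_iff successively_Cons\<close>)
  moreover have "odd (2 - j + int (length (c j # bs)))"
  proof (rule octagon_walk_parity)
    show "last (c j # bs) = c 2"
      using P(5) dec(1) by simp
  qed (use P dec in \<open>auto simp: successively_append_iff successively_Cons\<close>)
  ultimately have "odd ((j - i) + int (length ws))"
    using odd_lens by auto
  moreover have "even (x mod 8) \<longleftrightarrow> even x" for x :: int
    by presburger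
  ultimately have "odd ((j - i) mod 8 + int (length ws))"
    by auto
  with ear_span[OF ear dist] have "length ws = 1" and d4: "(j - i) mod 8 = 4"
    by auto
  then obtain w where ws: "ws = [w]"
    by (auto simp: length_1_2_3)
  have j: "c j = c (i + 4)"
  proof -
    have "8 dvd x - 4" if "x mod 8 = 4" for x :: int
      using that by presburger
    with d4 have "8 dvd j - i - 4"
      by blast
    then show ?thesis
      by (simp add: c_eq mod_eq_dvd_iff algebra_simps)
  qed
  define s where "s = Suc (length as)"
  have s: "0 < s" "s < 8" "P ! s = w" "P ! (s - 1) = c i" "P ! (s + 1) = c j"
    using lens by (simp_all add: s_def dec(1) ws nth_append)
  have w: "w \<notin> range c"
    using ear ws by (auto simp: ear_def)
  have setP: "set P = insert w (range c)"
  proof (rule card_subset_eq)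
    show "set P \<subseteq> insert w (range c)"
      using dec ws by auto
    show "card (set P) = card (insert w (range c))"
      using w P(3) distinct_card[OF P(1)] card_octagon by (simp add: range_octagon)
  qed (simp add: range_octagon)
  then have on_path: "c m \<in> set P" for m
    by simp
  have nth_inj: "P ! k = P ! l \<longleftrightarrow> k = l" if "k < 9" "l < 9" for k l
    using nth_eq_iff_index_eq[OF P(1)] P(3) that by simp
  have ends: "P ! 0 = c 0" "P ! 8 = c 2"
    using P(3-5) hd_conv_nth[of P] last_conv_nth[of P] by (fastforce, fastforce)
  have inner: "\<exists>k. 0 < k \<and> k < 8 \<and> P ! k = c m \<and> {P ! (k - 1), P ! (k + 1)} = {c (m - 1), c (m + 1)}"
    if m: "c m \<notin> {c 0, c 2, c i, c j}" for m
  proof -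
    obtain k where k: "k < 9" "P ! k = c m"
      using on_path P(3) by (metis in_set_conv_nth)
    have "k \<noteq> 0"
    proof
      assume "k = 0"
      with k(2) m ends(1) show False by simp
    qed
    moreover have "k \<noteq> 8"
    proof
      assume "k = 8"
      with k(2) m ends(2) show False by simp
    qed
    ultimately have k': "0 < k" "k < 8" using k(1) by auto
    have "E (P ! (k - 1)) (P ! k)" "E (P ! k) (P ! (k + 1))"
      using successively_nth[OF P(2), of "k - 1"] successively_nth[OF P(2), of k] P(3) k' by simp_all
    then have adj: "E (c m) (P ! (k - 1))" "E (c m) (P ! (k + 1))"
      using k(2) E_sym by auto
    \<comment> \<open>The neighbours of \<open>w\<close> on the path are the two ends of the ear, so \<open>w\<close> is not next to \<open>c m\<close>.\<close>
    have "k - 1 \<noteq> s" "k + 1 \<noteq> s"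
      using s k(2) k'(1) m by auto
    then have "P ! (k - 1) \<noteq> w" "P ! (k + 1) \<noteq> w"
      using s k' nth_inj[of _ s] by auto
    moreover have "P ! (k - 1) \<in> set P" "P ! (k + 1) \<in> set P"
      using k' P(3) by simp_all
    ultimately obtain a b where ab: "P ! (k - 1) = c a" "P ! (k + 1) = c b"
      using setP by auto
    have "P ! (k - 1) \<noteq> P ! (k + 1)"
      using nth_inj[of "k - 1" "k + 1"] k' by simp
    with ab adj octagon_neighbour[of m a] octagon_neighbour[of m b]
    have "{P ! (k - 1), P ! (k + 1)} = {c (m - 1), c (m + 1)}"
      by auto
    with k' k(2) show ?thesis by blast
  qed
  show False
  proof (cases "c 1 \<in> {c i, c j}")
    case False
    then obtain k where k: "0 < k" "k < 8" "{P ! (k - 1), P ! (k + 1)} = {P ! 0, P ! 8}"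
      using inner[of 1] ends by (auto simp: c_eq)
    then show False
      using nth_inj[of "k - 1" 0] nth_inj[of "k - 1" 8] nth_inj[of "k + 1" 0] nth_inj[of "k + 1" 8]
      by (auto simp: doubleton_eq_iff)
  next
    case True
    then have "c i = c 1 \<or> c (i + 4) = c 1"
      using j by auto
    moreover have "c i = c 1 \<Longrightarrow> c (i + 4) = c 5"
      unfolding c_eq mod_eq_dvd_iff by presburger
    moreover have "c (i + 4) = c 1 \<Longrightarrow> c i = c 5"
      unfolding c_eq mod_eq_dvd_iff by presburger
    ultimately have ij: "{c i, c j} = {c 1, c 5}"
      using j by auto
    obtain k where k: "0 < k" "k < 8" "P ! k = c 4" "c 5 \<in> {P ! (k - 1), P ! (k + 1)}"
      using inner[of 4] ij by (auto simp: c_eq)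
    obtain l where l: "0 < l" "l < 8" "P ! l = c 6" "c 5 \<in> {P ! (l - 1), P ! (l + 1)}"
      using inner[of 6] ij by (auto simp: c_eq)
    \<comment> \<open>Three different positions \<open>s\<close>, \<open>k\<close>, \<open>l\<close> would all be next to the position \<open>t\<close> of \<open>c 5\<close>.\<close>
    obtain t where t: "t < 9" "P ! t = c 5"
      using on_path P(3) by (metis in_set_conv_nth)
    have "c 5 \<in> {P ! (s - 1), P ! (s + 1)}"
      using s ij by auto
    then have "t + 1 = s \<or> t = s + 1"
      using t s(1,2) nth_inj[of t "s - 1"] nth_inj[of t "s + 1"] by auto
    moreover have "t + 1 = k \<or> t = k + 1"
      using t k(1,2,4) nth_inj[of t "k - 1"] nth_inj[of t "k + 1"] by auto
    moreover have "t + 1 = l \<or> t = l + 1"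
      using t l(1,2,4) nth_inj[of t "l - 1"] nth_inj[of t "l + 1"] by auto
    moreover have "k \<noteq> l" "k \<noteq> s" "l \<noteq> s"
      using k(3) l(3) s(3) w by (auto simp: c_eq)
    ultimately show False
      by (elim disjE) simp_all
  qed
qed

text \<open>A second excursion would start at or after the end of the first one. So its final vertex is not an
  end of the first ear, and the two ears have disjoint interiors and different pairs of ends.\<close>

lemma no_path_of_length_8:
  assumes P: "distinct P" "successively E P" "length P = 9" "hd P = c 0" "last P = c 2"
  shows False
proof -
  have P': "P \<noteq> []" "hd P \<in> range c" "last P \<in> range c"
    using P(3-5) by auto
  have "\<not> set P \<subseteq> range c"
  proof
    assume "set P \<subseteq> range c"
    then have "card (set P) \<le> card (range c)"
      by (intro card_mono) (simp_all add: range_octagon)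
    with P(3) distinct_card[OF P(1)] card_octagon show False by simp
  qed
  then obtain as a ws b bs where dec: "P = as @ a # ws @ b # bs" "set as \<subseteq> range c"
    "a \<in> range c" "b \<in> range c" "ws \<noteq> []" "set ws \<inter> range c = {}"
    by (rule first_excursion[OF P'])
  then obtain i j where ij: "a = c i" "b = c j" by blast
  have ear: "ear E c i ws j"
    using dec P(1,2) ij by (auto simp: ear_def successively_append_iff successively_Cons)
  show False
  proof (cases "set bs \<subseteq> range c")
    case True
    then show False
      using no_path_via_one_ear[OF P] dec ij ear by blast
  next
    case False
    then have later: "b # bs \<noteq> []" "hd (b # bs) \<in> range c" "last (b # bs) \<in> range c"
      "\<not> set (b # bs) \<subseteq> range c"
      using P(5) dec(1,4) by auto
    obtain as' a' ws' b' bs' where dec': "b # bs = as' @ a' # ws' @ b' # bs'"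
      "a' \<in> range c" "b' \<in> range c" "ws' \<noteq> []" "set ws' \<inter> range c = {}"
      by (rule first_excursion[OF later])
    then obtain k l where kl: "a' = c k" "b' = c l" by blast
    have P2: "P = (as @ a # ws) @ as' @ a' # ws' @ b' # bs'"
      using dec(1) dec'(1) by simp
    have distinct: "distinct ((as @ a # ws) @ as' @ a' # ws' @ b' # bs')"
      using P(1) unfolding P2 .
    have "ear E c k ws' l"
      using P2 P(1,2) dec' kl by (auto simp: ear_def successively_append_iff successively_Cons)
    moreover have "c k \<noteq> c l" "set ws \<inter> set ws' = {}" "b' \<noteq> a"
      using distinct kl by auto
    moreover have "c i \<noteq> c j"
      using P(1) dec(1) ij by auto
    moreover have "b' \<noteq> b"
      using dec' P(1) dec(1) by (cases as') auto
    ultimately show False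
      using no_two_ears[OF ear, of k ws' l] ij kl by auto
  qed
qed

end

section \<open>Cycles of the graph as vertex lists\<close>

text \<open>
  The edges of a path given by its vertices, each as a pair of opposite arcs, so that the arcs of the
  subgraph traversed by a closed walk are the links of its vertex list, first vertex repeated at the end.
\<close>

fun links :: "'a list \<Rightarrow> ('a \<times> 'a) set" where
  "links (x # y # zs) = {(x, y), (y, x)} \<union> links (y # zs)"
| "links _ = {}"

lemma links_subset: "links xs \<subseteq> set xs \<times> set xs"
  by (induction xs rule: links.induct) auto

lemma links_snoc: "xs \<noteq> [] \<Longrightarrow> links (xs @ [z]) = links xs \<union> {(last xs, z), (z, last xs)}"
  by (induction xs rule: links.induct) auto

text \<open>The first vertex of a path has only one edge on the path, so the edges determine the path once
  its first vertex is known. This is why different paths with common ends yield different cycles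
  as subgraphs, although a cycle forgets its starting point and direction.\<close>

lemma links_inj:
  assumes "distinct xs" "distinct ys" "xs \<noteq> []" "ys \<noteq> []" "hd xs = hd ys" "links xs = links ys"
  shows "xs = ys"
  using assms
proof (induction xs arbitrary: ys rule: links.induct)
  case (1 a x xs)
  obtain ys' where ys: "ys = a # ys'"
    using 1 by (cases ys) auto
  with 1 obtain y ys'' where ys': "ys' = y # ys''"
    by (cases ys') auto
  have a: "(a, b) \<notin> links (x # xs)" "(b, a) \<notin> links (x # xs)"
    "(a, b) \<notin> links (y # ys'')" "(b, a) \<notin> links (y # ys'')" for b
    using 1 ys ys' links_subset[of "x # xs"] links_subset[of "y # ys''"] by auto
  have eq: "{(a, x), (x, a)} \<union> links (x # xs) = {(a, y), (y, a)} \<union> links (y # ys'')"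
    using 1 ys ys' by simp
  then have "(a, x) \<in> {(a, y), (y, a)} \<union> links (y # ys'')"
    by blast
  with a(3)[of x] 1 have "x = y"
    by auto
  have "links (x # xs) = ({(a, x), (x, a)} \<union> links (x # xs)) - {(a, x), (x, a)}"
    using a(1,2)[of x] by auto
  also have "\<dots> = ({(a, y), (y, a)} \<union> links (y # ys'')) - {(a, y), (y, a)}"
    unfolding eq unfolding \<open>x = y\<close> ..
  also have "\<dots> = links (y # ys'')"
    using a(3,4)[of y] by auto
  finally have "links (x # xs) = links (y # ys'')" .
  with 1 ys ys' \<open>x = y\<close> have "x # xs = y # ys''"
    by (intro "1.IH") auto
  with ys ys' show ?case
    by simp
next
  case ("2_2" v)
  then show ?case by (cases ys rule: links.cases) auto
qed simp

definition cycle_graph :: "'a list \<Rightarrow> 'a pair_pre_digraph" where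
  "cycle_graph xs = \<lparr> pverts = set xs, parcs = links (xs @ [hd xs]) \<rparr>"

definition adjacent :: "'a pair_pre_digraph \<Rightarrow> 'a \<Rightarrow> 'a \<Rightarrow> bool" where
  "adjacent G x y \<longleftrightarrow> (x, y) \<in> parcs G"

definition closed_by :: "('a \<Rightarrow> 'a \<Rightarrow> bool) \<Rightarrow> 'a list \<Rightarrow> bool" where
  "closed_by R xs \<longleftrightarrow> distinct xs \<and> successively R xs \<and> R (last xs) (hd xs)"

lemma pcas_zip: "pcas u (zip (u # xs) (xs @ [v])) v"
  by (induction xs arbitrary: u) auto

lemma pawalk_verts_zip: "pawalk_verts u (zip (u # xs) (xs @ [v])) = u # xs @ [v]"
  by (induction xs arbitrary: u) auto

lemma pcas_imp_zip: "pcas u p v \<Longrightarrow> p \<noteq> [] \<Longrightarrow> \<exists>xs. p = zip (u # xs) (xs @ [v])"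
proof (induction u p v rule: pcas.induct)
  case (2 u e es v)
  then have e: "fst e = u" "pcas (snd e) es v"
    by simp_all
  show ?case
  proof (cases "es = []")
    case True
    with e have "e # es = zip (u # []) ([] @ [v])"
      by (simp add: prod_eq_iff)
    then show ?thesis ..
  next
    case False
    with 2 e obtain xs where "es = zip (snd e # xs) (xs @ [v])"
      by blast
    with e(1) have "e # es = zip (u # snd e # xs) ((snd e # xs) @ [v])"
      by (simp add: prod_eq_iff)
    then show ?thesis ..
  qed
qed simp

lemma zip_subset: "set (zip (u # xs) (xs @ [v])) \<subseteq> A \<longleftrightarrow> successively (\<lambda>x y. (x, y) \<in> A) (u # xs @ [v])"
  by (induction xs arbitrary: u) auto

lemma closed_by_iff_zip: "closed_by (adjacent G) (u # xs) \<longleftrightarrow>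
    distinct (xs @ [u]) \<and> set (zip (u # xs) (xs @ [u])) \<subseteq> parcs G"
  unfolding zip_subset closed_by_def adjacent_def
  by (cases "xs = []") (auto simp: successively_append_iff successively_Cons)

lemma cycle_iff_closed_by:
  "pre_digraph.cycle (with_proj G) p \<longleftrightarrow>
    (\<exists>u xs. p = zip (u # xs) (xs @ [u]) \<and> u \<in> pverts G \<and> closed_by (adjacent G) (u # xs))"
proof -
  have "pre_digraph.cycle (with_proj G) p \<longleftrightarrow> (\<exists>u. u \<in> pverts G \<and> set p \<subseteq> parcs G \<and> pcas u p u \<and>
      distinct (tl (pawalk_verts u p)) \<and> p \<noteq> [])"
    by (auto simp: pre_digraph.cycle_def pre_digraph.awalk_def cas_with_proj_eq awalk_verts_with_proj_eq)
  also have "\<dots> \<longleftrightarrow> (\<exists>u xs. p = zip (u # xs) (xs @ [u]) \<and> u \<in> pverts G \<and> closed_by (adjacent G) (u # xs))"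
  proof (intro iffI; elim exE conjE)
    fix u
    assume u: "u \<in> pverts G" "set p \<subseteq> parcs G" "pcas u p u" "distinct (tl (pawalk_verts u p))" "p \<noteq> []"
    then obtain xs where p: "p = zip (u # xs) (xs @ [u])"
      using pcas_imp_zip[OF u(3,5)] by blast
    have "closed_by (adjacent G) (u # xs)"
      unfolding closed_by_iff_zip using u(2,4) unfolding p pawalk_verts_zip by simp
    with p u(1) show "\<exists>u xs. p = zip (u # xs) (xs @ [u]) \<and> u \<in> pverts G \<and> closed_by (adjacent G) (u # xs)"
      by blast
  next
    fix u xs
    assume p: "p = zip (u # xs) (xs @ [u])" and u: "u \<in> pverts G" "closed_by (adjacent G) (u # xs)"
    have "zip (u # xs) (xs @ [u]) \<noteq> []"
      by (cases xs) simp_all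
    moreover have "distinct (tl (pawalk_verts u p))" "set p \<subseteq> parcs G" "pcas u p u"
      using u(2) pcas_zip[of u xs u] unfolding p pawalk_verts_zip closed_by_iff_zip by simp_all
    ultimately show "\<exists>u. u \<in> pverts G \<and> set p \<subseteq> parcs G \<and> pcas u p u \<and>
        distinct (tl (pawalk_verts u p)) \<and> p \<noteq> []"
      using p u(1) by blast
  qed
  finally show ?thesis .
qed

lemma walk_subgraph_zip: "walk_subgraph (zip (u # xs) (xs @ [u])) = cycle_graph (u # xs)"
proof -
  have parcs: "set (zip (u # xs) (xs @ [v])) \<union> (set (zip (u # xs) (xs @ [v])))\<inverse> = links (u # xs @ [v])" for v
    by (induction xs arbitrary: u) auto
  have "fst ` set (zip (u # xs) (xs @ [u])) = set (u # xs)"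
    by (simp flip: set_map)
  moreover have "snd ` set (zip (u # xs) (xs @ [u])) = set (xs @ [u])"
    using map_snd_zip[of "u # xs" "xs @ [u]"] by (metis length_Cons length_append_singleton set_map)
  ultimately show ?thesis
    unfolding walk_subgraph_def cycle_graph_def parcs by auto
qed

lemma cycles_eq:
  "cycles G k = {cycle_graph xs | xs. closed_by (adjacent G) xs \<and> length xs = k \<and> 3 \<le> k \<and> hd xs \<in> pverts G}"
proof -
  have "C \<in> cycles G k \<longleftrightarrow> (\<exists>u xs. C = walk_subgraph (zip (u # xs) (xs @ [u])) \<and>
      u \<in> pverts G \<and> closed_by (adjacent G) (u # xs) \<and> length (zip (u # xs) (xs @ [u])) = k \<and> 3 \<le> k)" for C
    unfolding cycles_def cycle_iff_closed_by by blast
  then have "C \<in> cycles G k \<longleftrightarrow> (\<exists>u xs. C = cycle_graph (u # xs) \<and>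
      u \<in> pverts G \<and> closed_by (adjacent G) (u # xs) \<and> length (u # xs) = k \<and> 3 \<le> k)" for C
    unfolding walk_subgraph_zip by simp
  moreover have "(\<exists>u xs. C = cycle_graph (u # xs) \<and>
      u \<in> pverts G \<and> closed_by (adjacent G) (u # xs) \<and> length (u # xs) = k \<and> 3 \<le> k) \<longleftrightarrow>
      (\<exists>xs. C = cycle_graph xs \<and> closed_by (adjacent G) xs \<and> length xs = k \<and> 3 \<le> k \<and> hd xs \<in> pverts G)" for C
  proof (intro iffI)
    assume "\<exists>xs. C = cycle_graph xs \<and> closed_by (adjacent G) xs \<and> length xs = k \<and> 3 \<le> k \<and> hd xs \<in> pverts G"
    then obtain xs where xs: "C = cycle_graph xs" "closed_by (adjacent G) xs" "length xs = k" "3 \<le> k" "hd xs \<in> pverts G"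
      by blast
    then obtain u ys where "xs = u # ys"
      by (cases xs) auto
    with xs show "\<exists>u xs. C = cycle_graph (u # xs) \<and>
      u \<in> pverts G \<and> closed_by (adjacent G) (u # xs) \<and> length (u # xs) = k \<and> 3 \<le> k"
      by (metis list.sel(1))
  qed (metis list.sel(1))
  ultimately show ?thesis
    by blast
qed

lemma not_successively_split:
  "\<not> successively R xs \<Longrightarrow> \<exists>us vs. xs = us @ vs \<and> us \<noteq> [] \<and> vs \<noteq> [] \<and> \<not> R (last us) (hd vs)"
proof (induction R xs rule: successively.induct)
  case (3 R x y zs)
  show ?case
  proof (cases "R x y")
    case True
    with 3 obtain us vs where "y # zs = us @ vs" "us \<noteq> []" "vs \<noteq> []" "\<not> R (last us) (hd vs)"
      by auto
    then show ?thesis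
      by (intro exI[of _ "x # us"] exI[of _ vs]) auto
  next
    case False
    then show ?thesis
      by (intro exI[of _ "[x]"] exI[of _ "y # zs"]) auto
  qed
qed auto

lemma closed_by_rotate:
  assumes "closed_by R (us @ vs)" "us \<noteq> []" "vs \<noteq> []"
  shows "closed_by R (vs @ us)"
  using assms by (auto simp: closed_by_def successively_append_iff)

text \<open>A closed walk that is not one of \<open>R\<close> uses the additional edge; cutting it there leaves a path of
  \<open>R\<close>, since a list of at least 3 different vertices has its first and last vertex next to each
  other only where it closes up.\<close>

lemma cycle_through_new_edge:
  assumes closed: "closed_by R' zs" and "3 \<le> length zs" "\<not> closed_by R zs"
    and R': "\<And>x y. R' x y \<Longrightarrow> R x y \<or> x = a \<and> y = b \<or> x = b \<and> y = a"
    and sym: "\<And>x y. R x y \<Longrightarrow> R y x"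
  obtains xs where "distinct xs" "successively R xs" "length xs = length zs" "hd xs = a" "last xs = b"
proof -
  obtain ys where ys: "closed_by R' ys" "length ys = length zs" "\<not> R (last ys) (hd ys)"
  proof (cases "R (last zs) (hd zs)")
    case False
    then show ?thesis
      using that closed by blast
  next
    case True
    then obtain us vs where "zs = us @ vs" "us \<noteq> []" "vs \<noteq> []" "\<not> R (last us) (hd vs)"
      using assms(1,3) not_successively_split[of R zs] by (auto simp: closed_by_def)
    then show ?thesis
      using that[of "vs @ us"] closed closed_by_rotate by auto
  qed
  have dist: "distinct ys" and len: "3 \<le> length ys"
    using ys assms(2) by (auto simp: closed_by_def)
  have ends: "last ys = a \<and> hd ys = b \<or> last ys = b \<and> hd ys = a"
    using ys R' by (auto simp: closed_by_def)
  have path: "successively R ys"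
    unfolding successively_conv_nth
  proof (intro allI impI)
    fix k
    assume k: "Suc k < length ys"
    have "R' (ys ! k) (ys ! Suc k)"
      using ys(1) k by (simp add: closed_by_def successively_nth)
    moreover have "\<not> (ys ! k \<in> {hd ys, last ys} \<and> ys ! Suc k \<in> {hd ys, last ys})"
    proof -
      have "ys \<noteq> []"
        using len by auto
      moreover from this have "hd ys = ys ! 0" "last ys = ys ! (length ys - 1)"
        by (simp_all add: hd_conv_nth last_conv_nth)
      ultimately show ?thesis
        using k len by (cases "length ys") (auto simp: nth_eq_iff_index_eq[OF dist])
    qed
    ultimately show "R (ys ! k) (ys ! Suc k)"
      using R' ends by blast
  qed
  show ?thesis
  proof (cases "hd ys = a")
    case True
    then show ?thesis
      using that[of ys] dist path ys(2) ends by auto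
  next
    case False
    have "successively R (rev ys)"
      unfolding successively_rev using path by (rule successively_mono) (auto intro: sym)
    then show ?thesis
      using that[of "rev ys"] dist ys(2) ends False len by (auto simp: hd_rev last_rev)
  qed
qed

section \<open>Uniquely saturated graphs\<close>

context pair_graph
begin

lemma adjacent_sym: "adjacent G x y \<Longrightarrow> adjacent G y x"
  unfolding adjacent_def by (rule arcs_symmetric)

lemma adjacent_in_pverts: "adjacent G x y \<Longrightarrow> x \<in> pverts G \<and> y \<in> pverts G"
  by (auto simp: adjacent_def dest: in_arcsD1 in_arcsD2)

lemma closed_by_in_cycles: "closed_by (adjacent G) xs \<Longrightarrow> 3 \<le> length xs \<Longrightarrow> cycle_graph xs \<in> cycles G (length xs)"
  unfolding cycles_eq using adjacent_in_pverts by (auto simp: closed_by_def)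

lemma links_adjacent: "successively (adjacent G) xs \<Longrightarrow> (x, y) \<in> links xs \<Longrightarrow> adjacent G x y"
  by (induction xs rule: links.induct) (auto intro: adjacent_sym)

text \<open>If the common ends are adjacent, one such path closes up to a cycle of length \<open>n\<close>. Otherwise the
  two paths close up to cycles of length \<open>n\<close> once the edge between the ends is added; these are equal
  subgraphs by saturation, and removing the new edge from them recovers the paths.\<close>

lemma saturated_unique_path:
  assumes sat: "uniquely_cycle_saturated n G" and n: "3 \<le> n"
    and xs: "distinct xs" "successively (adjacent G) xs" "length xs = n"
    and ys: "distinct ys" "successively (adjacent G) ys" "length ys = n"
    and ends: "hd xs = hd ys" "last xs = last ys"
  shows "xs = ys"
proof -
  define a b where "a = hd xs" and "b = last xs"
  have ne: "xs \<noteq> []" "ys \<noteq> []"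
    using n xs(3) ys(3) by auto
  obtain x where x: "adjacent G a x"
    using n xs by (cases xs rule: links.cases) (auto simp: a_def)
  obtain y where y: "adjacent G y b"
    using n xs(2,3) ne unfolding b_def
    by (cases xs rule: rev_cases) (auto simp: successively_append_iff)
  have verts: "a \<in> pverts G" "b \<in> pverts G"
    using x y adjacent_in_pverts by auto
  have "a \<noteq> b"
    using n xs(1,3) ne by (cases xs) (auto simp: a_def b_def)
  have no_edge: "\<not> adjacent G b a" "\<not> adjacent G a b"
  proof -
    show "\<not> adjacent G b a"
    proof
      assume "adjacent G b a"
      then have "cycle_graph xs \<in> cycles G n"
        using closed_by_in_cycles[of xs] xs n by (simp add: closed_by_def a_def b_def)
      with sat show False
        by (simp add: uniquely_cycle_saturated_def)
    qed
    then show "\<not> adjacent G a b"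
      using adjacent_sym by blast
  qed
  let ?H = "add_edge G a b"
  have in_H: "cycle_graph zs \<in> cycles ?H n"
    if "distinct zs" "successively (adjacent G) zs" "length zs = n" "hd zs = a" "last zs = b" for zs
  proof -
    have "successively (adjacent ?H) zs"
      using that(2) by (rule successively_mono) (simp add: adjacent_def add_edge_def)
    then have "closed_by (adjacent ?H) zs"
      using that by (simp add: closed_by_def adjacent_def add_edge_def)
    then show ?thesis
      unfolding cycles_eq using that n verts by (auto simp: add_edge_def)
  qed
  have "\<exists>!C. C \<in> cycles ?H n"
    using sat verts \<open>a \<noteq> b\<close> no_edge by (simp add: uniquely_cycle_saturated_def adjacent_def)
  then have "cycle_graph xs = cycle_graph ys"
    using in_H[of xs] in_H[of ys] xs ys ends by (metis a_def b_def)
  then have "links xs \<union> {(b, a), (a, b)} = links ys \<union> {(b, a), (a, b)}"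
    using ends ne by (simp add: cycle_graph_def links_snoc a_def b_def)
  moreover have "links zs = (links zs \<union> {(b, a), (a, b)}) - {(b, a), (a, b)}"
    if "successively (adjacent G) zs" for zs
    using links_adjacent[OF that] no_edge by auto
  ultimately have "links xs = links ys"
    using xs(2) ys(2) by metis
  then show ?thesis
    using links_inj xs ys ends ne by blast
qed

lemma saturated_path_exists:
  assumes sat: "uniquely_cycle_saturated n G" and n: "3 \<le> n"
    and ab: "a \<in> pverts G" "b \<in> pverts G" "a \<noteq> b" "\<not> adjacent G a b"
  obtains xs where "distinct xs" "successively (adjacent G) xs" "length xs = n" "hd xs = a" "last xs = b"
proof -
  have "\<exists>!C. C \<in> cycles (add_edge G a b) n"
    using sat ab unfolding uniquely_cycle_saturated_def adjacent_def by blast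
  then obtain C where "C \<in> cycles (add_edge G a b) n"
    by blast
  then obtain zs where zs: "closed_by (adjacent (add_edge G a b)) zs" "length zs = n"
    unfolding cycles_eq by blast
  have "\<not> closed_by (adjacent G) zs"
    using closed_by_in_cycles[of zs] zs(2) n sat by (auto simp: uniquely_cycle_saturated_def)
  moreover have "adjacent G x y \<or> x = a \<and> y = b \<or> x = b \<and> y = a"
    if "adjacent (add_edge G a b) x y" for x y
    using that by (auto simp: adjacent_def add_edge_def)
  ultimately obtain xs where "distinct xs" "successively (adjacent G) xs" "length xs = length zs"
    "hd xs = a" "last xs = b"
    using cycle_through_new_edge[OF zs(1), of "adjacent G" a b] n zs(2) adjacent_sym by blast
  then show ?thesis
    using that zs(2) by simp
qed

lemma chordless_octagon:
  assumes "C \<in> cycles G 8" "chordless G C"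
  obtains c :: "int \<Rightarrow> 'a" where
    "\<And>i j. c i = c j \<longleftrightarrow> i mod 8 = j mod 8"
    "\<And>i j. adjacent G (c i) (c j) \<longleftrightarrow> (i - j) mod 8 = 1 \<or> (i - j) mod 8 = 7"
proof -
  obtain zs where zs: "closed_by (adjacent G) zs" "length zs = 8" "C = cycle_graph zs"
    using assms(1) unfolding cycles_eq by blast
  obtain v0 v1 v2 v3 v4 v5 v6 v7 where vs: "zs = [v0, v1, v2, v3, v4, v5, v6, v7]"
    using zs(2) by (auto simp: length_Suc_conv numeral_eq_Suc)
  define c where "c i = zs ! nat (i mod 8)" for i
  have c_eq: "c i = c j \<longleftrightarrow> i mod 8 = j mod 8" for i j
    using zs(1,2) by (simp add: c_def closed_by_def nth_eq_iff_index_eq nat_less_iff eq_nat_nat_iff)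
  have zs_c: "zs = map c [0, 1, 2, 3, 4, 5, 6, 7]"
    by (simp add: c_def vs)
  have "c i \<in> set zs" for i
    using zs(2) by (simp add: c_def nat_less_iff)
  then have "adjacent G (c i) (c j) \<longleftrightarrow> (c i, c j) \<in> links (zs @ [hd zs])" for i j
    using assms(2) zs(1) links_adjacent[of "zs @ [hd zs]" "c i" "c j"]
    by (auto simp: chordless_def zs(3) cycle_graph_def adjacent_def closed_by_def successively_append_iff)
  also have "links (zs @ [hd zs]) = links (map c [0, 1, 2, 3, 4, 5, 6, 7, 0])"
    by (simp add: zs_c)
  finally have adj: "adjacent G (c i) (c j) \<longleftrightarrow>
      (c i, c j) \<in> links (map c [0, 1, 2, 3, 4, 5, 6, 7, 0])" for i j .
  have residue: "i mod 8 \<in> {0, 1, 2, 3, 4, 5, 6, 7}" for i :: int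
    using pos_mod_bound[of 8 i] pos_mod_sign[of 8 i] by auto
  have "adjacent G (c i) (c j) \<longleftrightarrow> (i - j) mod 8 = 1 \<or> (i - j) mod 8 = 7" for i j
    unfolding mod_diff_eq[of i 8 j, symmetric]
    using residue[of i] residue[of j] by (elim insertE emptyE) (simp_all add: adj c_eq)
  with c_eq show ?thesis
    by (rule that)
qed

lemma no_chordless_longest_even_octagon:
  assumes sat: "uniquely_cycle_saturated 9 G"
    and C: "C \<in> cycles G 8" "chordless G C" "longest_even_cycle_upto 12 G C"
  shows False
proof -
  obtain c :: "int \<Rightarrow> 'a" where c: "\<And>i j. c i = c j \<longleftrightarrow> i mod 8 = j mod 8"
    "\<And>i j. adjacent G (c i) (c j) \<longleftrightarrow> (i - j) mod 8 = 1 \<or> (i - j) mod 8 = 7"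
    using chordless_octagon[OF C(1,2)] by metis
  \<comment> \<open>The length of a cycle is the number of its vertices, so the bound on even cycles is 8.\<close>
  have length: "card (pverts C) = k" if "C \<in> cycles G k" for k
    using that unfolding cycles_eq by (auto simp: cycle_graph_def closed_by_def distinct_card)
  have longest: "j \<le> 8" if "D \<in> cycles G j" "even j" "j \<le> 12" for j D
    using C(3) that length[OF C(1)] length unfolding longest_even_cycle_upto_def by metis
  interpret saturated_octagon "adjacent G" c
  proof
    show False if "distinct xs" "successively (adjacent G) xs" "length xs \<in> {9, 10, 12}"
      "adjacent G (last xs) (hd xs)" for xs
    proof -
      have "cycle_graph xs \<in> cycles G (length xs)"
        using that by (intro closed_by_in_cycles) (auto simp: closed_by_def)
      with that(3) longest[of "cycle_graph xs" "length xs"] sat show False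
        by (auto simp: uniquely_cycle_saturated_def)
    qed
  qed (use c adjacent_sym saturated_unique_path[OF sat] in simp_all)
  have "c 0 \<in> pverts G" "c 2 \<in> pverts G" "c 0 \<noteq> c 2" "\<not> adjacent G (c 0) (c 2)"
    using adjacent_in_pverts[of "c 0" "c 1"] adjacent_in_pverts[of "c 2" "c 1"] by (simp_all add: c)
  then obtain P where "distinct P" "successively (adjacent G) P" "length P = 9" "hd P = c 0" "last P = c 2"
    by (rule saturated_path_exists[OF sat, rotated]) simp_all
  then show False
    by (rule no_path_of_length_8)
qed

end

theorem theorem7p9:
  shows "\<not> (\<exists>G :: 'a pair_pre_digraph.
           pair_graph G \<and> two_connected G \<and>
           uniquely_cycle_saturated 9 G \<and> nontrivial 9 G \<and>
           (\<exists>C. C \<in> cycles G 8 \<and> chordless G C \<and> longest_even_cycle_upto 12 G C))"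
  using pair_graph.no_chordless_longest_even_octagon by blast

end
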